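(* Let $A$ be a commutative (not necessarily associative) algebra over $\mathbb{R}$ equipped with a nondegenerate Frobenius form $(\cdot,\cdot)$ that satisfies the Norton inequality $(x^2,y^2)\geq (xy,xy)$ for all $x,y\in A$. If $e\in A$ is an idempotent, then both $A_0(e)$ and $A_1(e)$ are subalgebras of $A$, and they annihilate one another: $$A_0(e)A_1(e)=\{0\}.$$
   Context: An algebra here means a real vector space $A$ (of arbitrary dimension) with a bilinear commutative product, not necessarily associative and not necessarily unital. A Frobenius form on $A$ is a symmetric bilinear form $(\cdot,\cdot):A\times A\to\mathbb{R}$ with $(xy,z)=(x,yz)$ for all $x,y,z\in A$. It is nondegenerate if its radical $A^\perp=\{u\in A:(u,x)=0\ \text{for all } x\in A\}$ is $\{0\}$. For $x\in A$ and $\lambda\in\mathbb{R}$, $A_\lambda(x)=\{v\in A: xv=\lambda v\}$. An idempotent is an element $e\in A$ with $e^2=e$. A subalgebra is a linear subspace closed under the product (no unit is required). For subspaces $U,W\subseteq A$, $UW$ denotes the linear span of the products $uw$ with $u\in U$, $w\in W$. *)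

theory Defs
  imports "HOL-Analysis.Analysis"
begin

text \<open>
  The algebra is the whole type \<open>'a :: real_vector\<close>, of arbitrary dimension, with its product given
  as a function argument. It cannot be the product of the class \<open>real_algebra\<close>, which is associative.
\<close>

definition commutative_algebra :: "('a::real_vector \<Rightarrow> 'a \<Rightarrow> 'a) \<Rightarrow> bool" where
  "commutative_algebra p \<longleftrightarrow> bilinear p \<and> (\<forall>x y. p x y = p y x)"

definition frobenius_form :: "('a::real_vector \<Rightarrow> 'a \<Rightarrow> 'a) \<Rightarrow> ('a \<Rightarrow> 'a \<Rightarrow> real) \<Rightarrow> bool" where
  "frobenius_form p B \<longleftrightarrow>
     bilinear B \<and> (\<forall>x y. B x y = B y x) \<and> (\<forall>x y z. B (p x y) z = B x (p y z))"

definition form_radical :: "('a::real_vector \<Rightarrow> 'a \<Rightarrow> real) \<Rightarrow> 'a set" where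
  "form_radical B = {u. \<forall>x. B u x = 0}"

definition nondegenerate_form :: "('a::real_vector \<Rightarrow> 'a \<Rightarrow> real) \<Rightarrow> bool" where
  "nondegenerate_form B \<longleftrightarrow> form_radical B = {0}"

definition norton_inequality :: "('a::real_vector \<Rightarrow> 'a \<Rightarrow> 'a) \<Rightarrow> ('a \<Rightarrow> 'a \<Rightarrow> real) \<Rightarrow> bool" where
  "norton_inequality p B \<longleftrightarrow> (\<forall>x y. B (p x x) (p y y) \<ge> B (p x y) (p x y))"

definition idempotent :: "('a::real_vector \<Rightarrow> 'a \<Rightarrow> 'a) \<Rightarrow> 'a \<Rightarrow> bool" where
  "idempotent p e \<longleftrightarrow> p e e = e"

definition eigenspace :: "('a::real_vector \<Rightarrow> 'a \<Rightarrow> 'a) \<Rightarrow> real \<Rightarrow> 'a \<Rightarrow> 'a set" where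
  "eigenspace p l x = {v. p x v = l *\<^sub>R v}"

definition subalgebra :: "('a::real_vector \<Rightarrow> 'a \<Rightarrow> 'a) \<Rightarrow> 'a set \<Rightarrow> bool" where
  "subalgebra p S \<longleftrightarrow> subspace S \<and> (\<forall>x\<in>S. \<forall>y\<in>S. p x y \<in> S)"

definition subspace_product :: "('a::real_vector \<Rightarrow> 'a \<Rightarrow> 'a) \<Rightarrow> 'a set \<Rightarrow> 'a set \<Rightarrow> 'a set" where
  "subspace_product p U W = span {p u w | u w. u \<in> U \<and> w \<in> W}"

end

theory Submission
  imports Defs
begin

text \<open>
  For fixed \<open>x\<close>, the Norton inequality says that the symmetric bilinear form
  \<open>(y, z) \<mapsto> (x\<^sup>2, yz) - (xy, xz)\<close> is positive semidefinite. By associativity of the Frobenius form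
  it equals \<open>(x\<^sup>2 y - x(xy), z)\<close>. A null vector of a semidefinite form lies in its radical, so,
  the Frobenius form being nondegenerate, equality in the Norton inequality for \<open>x\<close> and \<open>y\<close> forces
  \<open>x\<^sup>2 y = x(xy)\<close> (lemma \<open>norton_equality\<close>). Equality is symmetric in \<open>x\<close> and \<open>y\<close>, so it also forces
  \<open>y\<^sup>2 x = y(yx)\<close>, and this exchange of roles is what drives the proof.

  Let \<open>e\<close> be an idempotent. Equality holds for \<open>e\<close> and every \<open>v\<close> with \<open>e(ev) = ev\<close>, in particular for
  every \<open>v\<close> in \<open>A\<^sub>0(e) + A\<^sub>1(e)\<close>, whence \<open>e v\<^sup>2 = v(ve)\<close>. Linearising this gives the fusion
  law \<open>e(uv) = (a + b)/2 uv\<close> for \<open>u \<in> A\<^sub>a(e)\<close> and \<open>v \<in> A\<^sub>b(e)\<close> with \<open>a, b \<in> {0, 1}\<close>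
  (lemma \<open>fusion\<close>). For \<open>a = b\<close> this says that \<open>A\<^sub>0(e)\<close> and \<open>A\<^sub>1(e)\<close> are closed under the product.

  For \<open>u \<in> A\<^sub>0(e)\<close> and \<open>v \<in> A\<^sub>1(e)\<close> it puts the product \<open>w = uv\<close> in \<open>A\<^bsub>1/2\<^esub>(e)\<close>. The form is not
  assumed definite, so \<open>w = 0\<close> needs one more use of the equality case. The Norton inequality for
  \<open>e\<close> and \<open>w\<close> gives \<open>(w, w) \<ge> 0\<close>; for \<open>u\<close> and \<open>v\<close> it gives \<open>(w, w) \<le> (u\<^sup>2, v\<^sup>2) = 0\<close>, since
  eigenspaces for different eigenvalues are orthogonal. So equality holds for \<open>e\<close> and \<open>w\<close>, and
  \<open>ew = e(ew)\<close> becomes \<open>w/2 = w/4\<close>.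
\<close>

text \<open>
  Along the line \<open>y + tz\<close> the quadratic form has no constant term, so its term linear in \<open>t\<close> must vanish
  for the values to stay nonnegative on both sides of \<open>t = 0\<close>.
\<close>

lemma psd_null_vector_in_radical:
  fixes S :: "'a::real_vector \<Rightarrow> 'a \<Rightarrow> real"
  assumes "bilinear S" and sym: "\<And>x y. S x y = S y x"
    and psd: "\<And>x. S x x \<ge> 0" and null: "S y y = 0"
  shows "S y z = 0"
proof -
  define c d where "c = S y z" and "d = S z z"
  have "S (y + t *\<^sub>R z) (y + t *\<^sub>R z) = 2 * t * c + t\<^sup>2 * d" for t
    using null sym[of z y] unfolding c_def d_def
    by (simp add: bilinear_ladd[OF assms(1)] bilinear_radd[OF assms(1)] bilinear_lmul[OF assms(1)]
        bilinear_rmul[OF assms(1)] algebra_simps power2_eq_square)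
  then have nonneg: "2 * t * c + t\<^sup>2 * d \<ge> 0" for t
    using psd by metis
  have d: "d \<ge> 0"
    using psd d_def by simp
  \<comment> \<open>Near the minimiser \<open>-c/d\<close>; the shift of \<open>d\<close> by 1 covers \<open>d = 0\<close>.\<close>
  have "2 * (- c / (d + 1)) * c + (- c / (d + 1))\<^sup>2 * d = - (c\<^sup>2 * (d + 2)) / (d + 1)\<^sup>2"
    using d by (simp add: divide_simps) (simp add: power2_eq_square algebra_simps)
  with nonneg[of "- c / (d + 1)"] have "c\<^sup>2 * (d + 2) / (d + 1)\<^sup>2 \<le> 0"
    by simp
  then have "c\<^sup>2 * (d + 2) \<le> 0"
    using d by (simp add: divide_le_0_iff)
  then have "c = 0"
    using d by (simp add: mult_le_0_iff)
  then show ?thesis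
    by (simp add: c_def)
qed

locale norton_algebra =
  fixes p :: "'a::real_vector \<Rightarrow> 'a \<Rightarrow> 'a" (infixl "\<cdot>" 70)
    and B :: "'a \<Rightarrow> 'a \<Rightarrow> real"
  assumes comm_alg: "commutative_algebra p"
    and frobenius: "frobenius_form p B"
    and nondegenerate: "nondegenerate_form B"
    and norton: "norton_inequality p B"
begin

lemma bilinear_product: "bilinear p"
  and product_commute: "x \<cdot> y = y \<cdot> x"
  using comm_alg unfolding commutative_algebra_def by blast+

lemma bilinear_form: "bilinear B"
  and form_commute: "B x y = B y x"
  and form_assoc: "B (x \<cdot> y) z = B x (y \<cdot> z)"
  using frobenius unfolding frobenius_form_def by blast+

lemmas product_simps =
  bilinear_ladd[OF bilinear_product] bilinear_radd[OF bilinear_product]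
  bilinear_lmul[OF bilinear_product] bilinear_rmul[OF bilinear_product]
  bilinear_lzero[OF bilinear_product] bilinear_rzero[OF bilinear_product]

lemmas form_simps =
  bilinear_ladd[OF bilinear_form] bilinear_radd[OF bilinear_form]
  bilinear_lmul[OF bilinear_form] bilinear_rmul[OF bilinear_form]
  bilinear_lsub[OF bilinear_form] bilinear_lzero[OF bilinear_form]

lemma form_eqI:
  assumes "\<And>z. B u z = B v z"
  shows "u = v"
proof -
  have "u - v \<in> form_radical B"
    using assms by (simp add: form_radical_def form_simps)
  then show ?thesis
    using nondegenerate by (simp add: nondegenerate_form_def)
qed

text \<open>
  \<open>y\<close> is a null vector of the semidefinite form \<open>(y, z) \<mapsto> (x\<^sup>2, yz) - (xy, xz)\<close>, hence in its radical.
\<close>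

lemma norton_equality:
  assumes eq: "B (x \<cdot> x) (y \<cdot> y) = B (x \<cdot> y) (x \<cdot> y)"
  shows "(x \<cdot> x) \<cdot> y = x \<cdot> (x \<cdot> y)"
proof (rule form_eqI)
  fix z
  define S where "S = (\<lambda>y z. B (x \<cdot> x) (y \<cdot> z) - B (x \<cdot> y) (x \<cdot> z))"
  have "bilinear S"
    unfolding bilinear_def S_def
    by (auto intro!: linearI simp: product_simps form_simps algebra_simps)
  moreover have "S u v = S v u" for u v
    by (simp add: S_def product_commute[of u v] form_commute[of "x \<cdot> u" "x \<cdot> v"])
  moreover have "S u u \<ge> 0" for u
    using norton by (simp add: S_def norton_inequality_def)
  moreover have "S y y = 0"
    using eq by (simp add: S_def)
  ultimately have "S y z = 0"
    by (rule psd_null_vector_in_radical)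
  then have "B ((x \<cdot> x) \<cdot> y) z = B (x \<cdot> y) (x \<cdot> z)"
    by (simp add: S_def form_assoc)
  also have "\<dots> = B (x \<cdot> (x \<cdot> y)) z"
    by (metis form_assoc product_commute)
  finally show "B ((x \<cdot> x) \<cdot> y) z = B (x \<cdot> (x \<cdot> y)) z" .
qed

lemma eigenspaces_orthogonal:
  assumes "u \<in> eigenspace p a e" "v \<in> eigenspace p b e" "a \<noteq> b"
  shows "B u v = 0"
proof -
  have "a * B u v = B (e \<cdot> u) v"
    using assms(1) by (simp add: eigenspace_def form_simps)
  also have "\<dots> = B u (e \<cdot> v)"
    by (metis form_assoc product_commute)
  also have "\<dots> = b * B u v"
    using assms(2) by (simp add: eigenspace_def form_simps)
  finally show ?thesis
    using assms(3) by simp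
qed

lemma subspace_eigenspace: "subspace (eigenspace p a e)"
  unfolding subspace_def eigenspace_def by (simp add: product_simps scaleR_add_right)

context
  fixes e
  assumes idem: "idempotent p e"
begin

text \<open>
  The hypothesis makes \<open>e\<close> and \<open>v\<close> a case of equality in the Norton inequality; the conclusion is
  what equality forces after \<open>e\<close> and \<open>v\<close> have exchanged their roles.
\<close>

lemma idempotent_times_square:
  assumes "e \<cdot> (e \<cdot> v) = e \<cdot> v"
  shows "e \<cdot> (v \<cdot> v) = v \<cdot> (e \<cdot> v)"
proof -
  have "B (e \<cdot> e) (v \<cdot> v) = B (e \<cdot> v) v"
    using idem by (simp add: idempotent_def form_assoc)
  also have "\<dots> = B v (e \<cdot> (e \<cdot> v))"
    using assms by (simp add: form_commute)
  also have "\<dots> = B (e \<cdot> v) (e \<cdot> v)"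
    by (metis form_assoc product_commute)
  finally have "B (v \<cdot> v) (e \<cdot> e) = B (v \<cdot> e) (v \<cdot> e)"
    by (simp add: form_commute product_commute[of v e])
  then show ?thesis
    using norton_equality product_commute by metis
qed

text \<open>The polarisation of the preceding identity.\<close>

lemma idempotent_half_derivation:
  assumes u: "e \<cdot> (e \<cdot> u) = e \<cdot> u" and v: "e \<cdot> (e \<cdot> v) = e \<cdot> v"
  shows "2 *\<^sub>R (e \<cdot> (u \<cdot> v)) = (e \<cdot> u) \<cdot> v + u \<cdot> (e \<cdot> v)"
proof -
  have "e \<cdot> ((u + v) \<cdot> (u + v)) = (u + v) \<cdot> (e \<cdot> (u + v))"
    by (rule idempotent_times_square) (simp add: product_simps u v)
  then have "e \<cdot> (u \<cdot> v) + e \<cdot> (u \<cdot> v) = v \<cdot> (e \<cdot> u) + u \<cdot> (e \<cdot> v)"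
    using idempotent_times_square[OF u] idempotent_times_square[OF v]
    by (simp add: product_simps product_commute[of v u] algebra_simps)
  then show ?thesis
    by (simp add: scaleR_2 product_commute[of v "e \<cdot> u"])
qed

lemma fusion:
  assumes "u \<in> eigenspace p a e" "v \<in> eigenspace p b e" "a \<in> {0, 1}" "b \<in> {0, 1}"
  shows "u \<cdot> v \<in> eigenspace p ((a + b) / 2) e"
proof -
  have u: "e \<cdot> u = a *\<^sub>R u" and v: "e \<cdot> v = b *\<^sub>R v"
    using assms by (simp_all add: eigenspace_def)
  have "e \<cdot> (e \<cdot> u) = e \<cdot> u" "e \<cdot> (e \<cdot> v) = e \<cdot> v"
    using u v assms(3,4) by (auto simp: product_simps)
  then have twice: "2 *\<^sub>R (e \<cdot> (u \<cdot> v)) = (a + b) *\<^sub>R (u \<cdot> v)"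
    using idempotent_half_derivation[of u v] by (simp add: u v product_simps scaleR_add_left)
  have "e \<cdot> (u \<cdot> v) = (1 / 2) *\<^sub>R (2 *\<^sub>R (e \<cdot> (u \<cdot> v)))"
    by simp
  also have "\<dots> = ((a + b) / 2) *\<^sub>R (u \<cdot> v)"
    unfolding twice by simp
  finally show ?thesis
    by (simp add: eigenspace_def)
qed

lemma subalgebra_eigenspace:
  assumes "a \<in> {0, 1}"
  shows "subalgebra p (eigenspace p a e)"
  unfolding subalgebra_def
proof (intro conjI ballI subspace_eigenspace)
  fix u v
  assume "u \<in> eigenspace p a e" "v \<in> eigenspace p a e"
  from fusion[OF this assms assms] show "u \<cdot> v \<in> eigenspace p a e"
    by simp
qed

text \<open>
  On \<open>A\<^bsub>1/2\<^esub>(e)\<close> the defect in the Norton inequality for \<open>e\<close> and \<open>w\<close> is \<open>(w, w)/4\<close>, so the form is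
  positive semidefinite there, and definite because equality forces \<open>w/2 = w/4\<close>.
\<close>

lemma form_definite_on_half_eigenspace:
  assumes "w \<in> eigenspace p (1 / 2) e" "B w w \<le> 0"
  shows "w = 0"
proof -
  have w: "e \<cdot> w = (1 / 2) *\<^sub>R w"
    using assms(1) by (simp add: eigenspace_def)
  have half: "B (e \<cdot> e) (w \<cdot> w) = B w w / 2"
    using idem form_assoc[of e w w] by (simp add: idempotent_def w form_simps)
  moreover have quarter: "B (e \<cdot> w) (e \<cdot> w) = B w w / 4"
    by (simp add: w form_simps)
  moreover have "B (e \<cdot> e) (w \<cdot> w) \<ge> B (e \<cdot> w) (e \<cdot> w)"
    using norton by (simp add: norton_inequality_def)
  ultimately have "B w w = 0"
    using assms(2) by simp
  then have "(e \<cdot> e) \<cdot> w = e \<cdot> (e \<cdot> w)"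
    using half quarter by (intro norton_equality) simp
  then have "(1 / 2) *\<^sub>R w = (1 / 4) *\<^sub>R w"
    using idem by (simp add: idempotent_def w product_simps)
  then show ?thesis
    by simp
qed

lemma eigenspaces_annihilate:
  assumes "u \<in> eigenspace p 0 e" "v \<in> eigenspace p 1 e"
  shows "u \<cdot> v = 0"
proof (rule form_definite_on_half_eigenspace)
  show "u \<cdot> v \<in> eigenspace p (1 / 2) e"
    using fusion[OF assms] by simp
  have "u \<cdot> u \<in> eigenspace p 0 e" "v \<cdot> v \<in> eigenspace p 1 e"
    using fusion[OF assms(1) assms(1)] fusion[OF assms(2) assms(2)] by simp_all
  then have "B (u \<cdot> u) (v \<cdot> v) = 0"
    by (rule eigenspaces_orthogonal) simp
  then show "B (u \<cdot> v) (u \<cdot> v) \<le> 0"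
    using norton unfolding norton_inequality_def by metis
qed

end

end

theorem corollary3p4:
  fixes p :: "'a::real_vector \<Rightarrow> 'a \<Rightarrow> 'a"
    and B :: "'a \<Rightarrow> 'a \<Rightarrow> real"
    and e :: 'a
  assumes "commutative_algebra p"
    and "frobenius_form p B"
    and "nondegenerate_form B"
    and "norton_inequality p B"
    and "idempotent p e"
  shows "subalgebra p (eigenspace p 0 e) \<and> subalgebra p (eigenspace p 1 e)
    \<and> subspace_product p (eigenspace p 0 e) (eigenspace p 1 e) = {0}"
proof -
  interpret norton_algebra p B
    using assms(1-4) by unfold_locales
  have "{p u v | u v. u \<in> eigenspace p 0 e \<and> v \<in> eigenspace p 1 e} \<subseteq> {0}"
    using eigenspaces_annihilate[OF assms(5)] by blast
  then have "subspace_product p (eigenspace p 0 e) (eigenspace p 1 e) \<subseteq> span {0}"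
    unfolding subspace_product_def by (rule span_mono)
  then have "subspace_product p (eigenspace p 0 e) (eigenspace p 1 e) = {0}"
    using span_zero by (auto simp: subspace_product_def)
  then show ?thesis
    using subalgebra_eigenspace[OF assms(5)] by simp
qed

end
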